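(* Let $\mathbf{k}$ be a field of characteristic $0$. Every multiplicative right Hom-alternative algebra $(A,\mu,\alpha)$ over $\mathbf{k}$ is Hom-Jordan admissible.
   Context: We work over a fixed field $\mathbf{k}$ of characteristic $0$. A Hom-algebra is a triple $(A,\mu,\alpha)$ where $A$ is a $\mathbf{k}$-module, $\mu\colon A^{\otimes 2}\to A$ is bilinear (written $xy=\mu(x,y)$), and $\alpha\colon A\to A$ is linear. It is multiplicative if $\alpha(xy)=\alpha(x)\alpha(y)$ for all $x,y\in A$. The Hom-associator of $(A,\mu,\alpha)$ is $as_A(x,y,z)=(xy)\alpha(z)-\alpha(x)(yz)$. $A$ is right Hom-alternative if $as_A(x,y,y)=0$ for all $x,y\in A$. A Hom-algebra $(A,\mu,\alpha)$ is a Hom-Jordan algebra if $\mu$ is commutative and $as_A(x^2,\alpha(y),\alpha(x))=0$ for all $x,y\in A$, where $x^2=\mu(x,x)$. The plus Hom-algebra of $(A,\mu,\alpha)$ is $A^+=(A,\ast,\alpha)$ with $x\ast y=\frac12(xy+yx)$. $A$ is Hom-Jordan admissible if $A^+$ is a Hom-Jordan algebra. *)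

theory Defs
  imports Complex_Main
begin

text \<open>The base field is the type of the scalars, and the module is a whole type together with
  an explicit scalar multiplication \<open>scale\<close>.\<close>

locale hom_algebra = vector_space scale
  for scale :: "'k::field_char_0 \<Rightarrow> 'a::ab_group_add \<Rightarrow> 'a" +
  fixes mu :: "'a \<Rightarrow> 'a \<Rightarrow> 'a"
    and alpha :: "'a \<Rightarrow> 'a"
  assumes linear_mu_left: "\<And>y. Vector_Spaces.linear scale scale (\<lambda>x. mu x y)"
    and linear_mu_right: "\<And>x. Vector_Spaces.linear scale scale (\<lambda>y. mu x y)"
    and linear_alpha: "Vector_Spaces.linear scale scale alpha"

definition hom_associator ::
    "('a::ab_group_add \<Rightarrow> 'a \<Rightarrow> 'a) \<Rightarrow> ('a \<Rightarrow> 'a) \<Rightarrow> 'a \<Rightarrow> 'a \<Rightarrow> 'a \<Rightarrow> 'a"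
  where "hom_associator mu alpha x y z = mu (mu x y) (alpha z) - mu (alpha x) (mu y z)"

locale multiplicative_hom_algebra = hom_algebra +
  assumes multiplicative: "\<And>x y. alpha (mu x y) = mu (alpha x) (alpha y)"

locale right_hom_alternative_algebra = hom_algebra +
  assumes right_hom_alternative: "\<And>x y. hom_associator mu alpha x y y = 0"

locale hom_jordan_algebra = hom_algebra +
  assumes mu_commute: "\<And>x y. mu x y = mu y x"
    and hom_jordan_identity: "\<And>x y. hom_associator mu alpha (mu x x) (alpha y) (alpha x) = 0"

definition plus_product ::
    "('k::field_char_0 \<Rightarrow> 'a::ab_group_add \<Rightarrow> 'a) \<Rightarrow> ('a \<Rightarrow> 'a \<Rightarrow> 'a) \<Rightarrow> 'a \<Rightarrow> 'a \<Rightarrow> 'a"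
  where "plus_product scale mu x y = scale (1 / 2) (mu x y + mu y x)"

definition hom_jordan_admissible ::
    "('k::field_char_0 \<Rightarrow> 'a::ab_group_add \<Rightarrow> 'a) \<Rightarrow> ('a \<Rightarrow> 'a \<Rightarrow> 'a) \<Rightarrow> ('a \<Rightarrow> 'a) \<Rightarrow> bool"
  where "hom_jordan_admissible scale mu alpha \<longleftrightarrow>
    hom_jordan_algebra scale (plus_product scale mu) alpha"

end

theory Submission
  imports Defs
begin

text \<open>
  Write \<open>x \<circ> y = xy + yx\<close>. The product of \<open>A\<^sup>+\<close> is half of it, so up to the factor \<open>1/4\<close> the
  Hom-Jordan identity of \<open>A\<^sup>+\<close> reads
  \<open>(x\<^sup>2 \<circ> \<alpha>(y)) \<circ> \<alpha>\<^sup>2(x) = \<alpha>(x\<^sup>2) \<circ> (\<alpha>(y) \<circ> \<alpha>(x))\<close>, where both sides are sums of four monomials in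
  the product of \<open>A\<close>.

  In the classical case, the right multiplications of a right alternative algebra satisfy
  \<open>R(y) R(z) + R(z) R(y) = R(y \<circ> z)\<close>, and \<open>R\<close> is injective once a unit is adjoined, which embeds
  \<open>A\<^sup>+\<close> into a special Jordan algebra. With a twisting map, adjoining a unit is no longer
  available in general, so the argument here is a direct one. It uses the same operator identity
  in its twisted form (\<open>right_hom_alternative_linearized\<close>) twice: once to expand
  \<open>\<alpha>\<^sup>2(x)(x\<^sup>2 \<circ> \<alpha>(y))\<close>, and once to collect terms into \<open>\<alpha>(x\<^sup>2)(\<alpha>(y) \<circ> \<alpha>(x))\<close>. The expansion
  also yields \<open>(\<alpha>(x)\<alpha>(y))\<alpha>(x\<^sup>2)\<close>, which occurs on the right-hand side as it stands. The one
  monomial that then remains on each side is settled by the twisted form of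
  \<open>R(x) R(x\<^sup>2) = R(x\<^sup>2) R(x)\<close> (\<open>right_mult_square_commute\<close>), where multiplicativity enters.
\<close>

context hom_algebra
begin

lemma mu_add_left: "mu (x + y) z = mu x z + mu y z"
  using linear_mu_left[of z] by (simp add: Vector_Spaces.linear_iff)

lemma mu_add_right: "mu x (y + z) = mu x y + mu x z"
  using linear_mu_right[of x] by (simp add: Vector_Spaces.linear_iff)

lemma mu_scale_left: "mu (scale c x) y = scale c (mu x y)"
  using linear_mu_left[of y] by (simp add: Vector_Spaces.linear_iff)

lemma mu_scale_right: "mu x (scale c y) = scale c (mu x y)"
  using linear_mu_right[of x] by (simp add: Vector_Spaces.linear_iff)

lemma alpha_add: "alpha (x + y) = alpha x + alpha y"
  using linear_alpha by (simp add: Vector_Spaces.linear_iff)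

lemma plus_product_commute: "plus_product scale mu x y = plus_product scale mu y x"
  by (simp add: plus_product_def add.commute)

lemma plus_product_self: "plus_product scale mu x x = mu x x"
proof -
  have "plus_product scale mu x x = scale (1 / 2 + 1 / 2) (mu x x)"
    unfolding plus_product_def by (simp only: scale_right_distrib scale_left_distrib)
  then show ?thesis by simp
qed

lemma hom_algebra_plus_product: "hom_algebra scale (plus_product scale mu) alpha"
proof -
  have left: "Vector_Spaces.linear scale scale (\<lambda>x. plus_product scale mu x y)" for y
    unfolding Vector_Spaces.linear_iff plus_product_def
    by (simp add: vector_space_axioms mu_add_left mu_add_right mu_scale_left mu_scale_right
        scale_right_distrib mult.commute ac_simps)
  then have right: "Vector_Spaces.linear scale scale (\<lambda>y. plus_product scale mu x y)" for x
    by (subst plus_product_commute)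
  show ?thesis
    by (intro hom_algebra.intro hom_algebra_axioms.intro vector_space_axioms left right linear_alpha)
qed

end

context right_hom_alternative_algebra
begin

lemma right_hom_alternative_mult: "mu (mu x y) (alpha y) = mu (alpha x) (mu y y)"
  using right_hom_alternative[of x y] by (simp add: hom_associator_def)

text \<open>Polarization of the right Hom-alternative law: expand it at \<open>y + z\<close> and subtract its
  instances at \<open>y\<close> and \<open>z\<close>.\<close>

lemma right_hom_alternative_linearized:
  "mu (mu x y) (alpha z) + mu (mu x z) (alpha y) = mu (alpha x) (mu y z + mu z y)"
  using right_hom_alternative_mult[of x "y + z"]
    right_hom_alternative_mult[of x y] right_hom_alternative_mult[of x z]
  by (simp add: mu_add_left mu_add_right alpha_add algebra_simps)

end

locale multiplicative_right_hom_alternative_algebra =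
  multiplicative_hom_algebra + right_hom_alternative_algebra
begin

text \<open>Both sides are rebracketings of \<open>((yx)\<alpha>(x))\<alpha>\<^sup>2(x)\<close>: the right Hom-alternative law merges
  either the first two or the last two of the three factors \<open>x\<close>.\<close>

lemma right_mult_square_commute:
  "mu (mu (alpha y) (mu x x)) (alpha (alpha x)) = mu (mu (alpha y) (alpha x)) (alpha (mu x x))"
proof -
  have "mu (mu (alpha y) (mu x x)) (alpha (alpha x)) = mu (mu (mu y x) (alpha x)) (alpha (alpha x))"
    by (simp only: right_hom_alternative_mult)
  also have "\<dots> = mu (alpha (mu y x)) (mu (alpha x) (alpha x))"
    by (rule right_hom_alternative_mult)
  finally show ?thesis by (simp only: multiplicative)
qed

text \<open>The Hom-Jordan identity of \<open>A\<^sup>+\<close> with the scalar factors cleared.\<close>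

lemma jordan_identity_cleared:
  fixes x y :: 'b
  defines "s \<equiv> mu x x"
  defines "p \<equiv> mu s (alpha y) + mu (alpha y) s"
    and "q \<equiv> mu (alpha y) (alpha x) + mu (alpha x) (alpha y)"
  shows "mu p (alpha (alpha x)) + mu (alpha (alpha x)) p = mu (alpha s) q + mu q (alpha s)"
proof -
  have cube: "mu (alpha x) s = mu s (alpha x)"
    by (simp only: s_def right_hom_alternative_mult)
  have expand: "mu (alpha (alpha x)) p
      = mu (mu s (alpha x)) (alpha (alpha y)) + mu (mu (alpha x) (alpha y)) (alpha s)"
    unfolding p_def by (simp only: right_hom_alternative_linearized[symmetric] cube)
  have collect: "mu (mu s (alpha y)) (alpha (alpha x)) + mu (mu s (alpha x)) (alpha (alpha y))
      = mu (alpha s) q"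
    unfolding q_def by (rule right_hom_alternative_linearized)
  have remaining: "mu (mu (alpha y) s) (alpha (alpha x)) = mu (mu (alpha y) (alpha x)) (alpha s)"
    unfolding s_def by (rule right_mult_square_commute)
  have "mu p (alpha (alpha x)) + mu (alpha (alpha x)) p
      = (mu (mu s (alpha y)) (alpha (alpha x)) + mu (mu s (alpha x)) (alpha (alpha y)))
        + (mu (mu (alpha y) s) (alpha (alpha x)) + mu (mu (alpha x) (alpha y)) (alpha s))"
    unfolding expand unfolding p_def by (simp only: mu_add_left ac_simps)
  also have "\<dots> = mu (alpha s) q + mu q (alpha s)"
    unfolding collect remaining unfolding q_def by (simp only: mu_add_left)
  finally show ?thesis .
qed

lemma plus_product_hom_jordan_identity:
  "hom_associator (plus_product scale mu) alpha (plus_product scale mu x x) (alpha y) (alpha x) = 0"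
  using jordan_identity_cleared[of x y]
  unfolding hom_associator_def plus_product_self
  by (simp add: plus_product_def mu_scale_left mu_scale_right
      scale_right_distrib[symmetric] scale_right_diff_distrib[symmetric])

end

theorem theorem4p3:
  fixes scale :: "'k::field_char_0 \<Rightarrow> 'a::ab_group_add \<Rightarrow> 'a"
    and mu :: "'a \<Rightarrow> 'a \<Rightarrow> 'a"
    and alpha :: "'a \<Rightarrow> 'a"
  assumes "multiplicative_hom_algebra scale mu alpha"
    and "right_hom_alternative_algebra scale mu alpha"
  shows "hom_jordan_admissible scale mu alpha"
proof -
  interpret multiplicative_right_hom_alternative_algebra scale mu alpha
    using assms by (rule multiplicative_right_hom_alternative_algebra.intro)
  show ?thesis
    unfolding hom_jordan_admissible_def
    by (intro hom_jordan_algebra.intro hom_jordan_algebra_axioms.intro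
        hom_algebra_plus_product plus_product_commute plus_product_hom_jordan_identity)
qed

end
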